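(* Suppose that $(K,S,N)$ is an $\mathcal O$N-structure (resp. a dual $\mathcal O$N-structure) on a Leibniz algebra $(\mathfrak g,[\ ,\ ])$ associated with a representation $(V,\rho^L,\rho^R)$. Then: (i) $K$ is an $\mathcal O$-operator on the Leibniz algebra $(\mathfrak g,[\ ,\ ]_N)$ associated to the representation $(V,\hat{\rho^L},\hat{\rho^R})$ (resp. $(V,\tilde{\rho^L},\tilde{\rho^R})$); (ii) $NK$ is an $\mathcal O$-operator on $(\mathfrak g,[\ ,\ ])$ with respect to the representation $(V,\rho^L,\rho^R)$.
   Context: $k$ is a field of characteristic $0$; all vector spaces are finite dimensional over $k$. A (left) Leibniz algebra $(\mathfrak g,[\ ,\ ])$ is a vector space with a bilinear bracket satisfying $[x,[y,z]]=[[x,y],z]+[y,[x,z]]$. A representation $(V,\rho^L,\rho^R)$ of it is a vector space $V$ with linear maps $\rho^L,\rho^R:\mathfrak g\to\mathfrak{gl}(V)$ such that for all $x,y\in\mathfrak g$: $\rho^L([x,y])=[\rho^L(x),\rho^L(y)]$, $\rho^R([x,y])=[\rho^L(x),\rho^R(y)]$ (commutators), and $\rho^R(y)\rho^L(x)=-\rho^R(y)\rho^R(x)$. An $\mathcal O$-operator on $\mathfrak g$ associated to (with respect to) $(V,\rho^L,\rho^R)$ is a linear map $K:V\to\mathfrak g$ with $[K(u),K(v)]=K(\rho^L(K(u))v+\rho^R(K(v))u)$. Put $[u,v]^K=\rho^L(K(u))v+\rho^R(K(v))u$. A Nijenhuis operator on $\mathfrak g$ is a linear endomorphism $N$ with $[N(x),N(y)]=N([x,y]_N)$,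 where $[x,y]_N=[N(x),y]+[x,N(y)]-N[x,y]$; then $(\mathfrak g,[\ ,\ ]_N)$ is a Leibniz algebra. A pair $(N,S)$, $N\in\mathfrak{gl}(\mathfrak g)$, $S\in\mathfrak{gl}(V)$, is a Nijenhuis pair if $N$ is a Nijenhuis operator and for all $y\in\mathfrak g$, $w\in V$ and each $\rho\in\{\rho^L,\rho^R\}$: $\rho(N(y))S(w)=S(\rho(N(y))w)+S(\rho(y)S(w))-S^2(\rho(y)w)$. It is a dual-Nijenhuis pair if $N$ is a Nijenhuis operator and for all $y,w$ and each such $\rho$: $\rho(N(y))S(w)=S(\rho(N(y))w)+\rho(y)S^2(w)-S(\rho(y)S(w))$. The triple $(K,S,N)$ is an $\mathcal O$N-structure (resp. dual $\mathcal O$N-structure) if $K$ is an $\mathcal O$-operator, $(N,S)$ is a Nijenhuis pair (resp. dual-Nijenhuis pair), $NK=KS$, and $[w,u]^{NK}=[w,u]_S^K$ for all $w,u\in V$, where $[w,u]^{NK}=\rho^L(NK(w))u+\rho^R(NK(u))w$ and $[w,u]_S^K=[S(w),u]^K+[w,S(u)]^K-S[w,u]^K$. For $\rho\in\{\rho^L,\rho^R\}$ and $y\in\mathfrak g$: $\hat\rho(y)=\rho(N(y))+\rho(y)S-S\rho(y)$ and $\tilde\rho(y)=\rho(N(y))+S\rho(y)-\rho(y)S$. If $(N,S)$ is a Nijenhuis pair (resp. dual-Nijenhuis pair), then $(V,\hat{\rho^L},\hat{\rho^R})$ (resp. $(V,\tilde{\rho^L},\tilde{\rho^R})$) is a representation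 of $(\mathfrak g,[\ ,\ ]_N)$. *)

theory Defs
  imports Complex_Main
begin

definition fin_dim_vector_space :: "('k::field_char_0 \<Rightarrow> 'a::ab_group_add \<Rightarrow> 'a) \<Rightarrow> bool" where
  "fin_dim_vector_space scale \<longleftrightarrow> (\<exists>Basis. finite_dimensional_vector_space scale Basis)"

definition bilinear_map ::
  "('k::field_char_0 \<Rightarrow> 'a::ab_group_add \<Rightarrow> 'a) \<Rightarrow> ('k \<Rightarrow> 'b::ab_group_add \<Rightarrow> 'b) \<Rightarrow>
   ('k \<Rightarrow> 'c::ab_group_add \<Rightarrow> 'c) \<Rightarrow> ('a \<Rightarrow> 'b \<Rightarrow> 'c) \<Rightarrow> bool" where
  "bilinear_map sa sb sc f \<longleftrightarrow>
     (\<forall>x. Vector_Spaces.linear sb sc (\<lambda>y. f x y)) \<and>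
     (\<forall>y. Vector_Spaces.linear sa sc (\<lambda>x. f x y))"

text \<open>Left Leibniz algebras on a type \<open>'g\<close> whose scalar multiplication is \<open>sg\<close>.\<close>

locale leibniz_algebra =
  fixes sg :: "'k::field_char_0 \<Rightarrow> 'g::ab_group_add \<Rightarrow> 'g"
    and br :: "'g \<Rightarrow> 'g \<Rightarrow> 'g"
  assumes fin_dim_algebra: "fin_dim_vector_space sg"
    and bilinear_bracket: "bilinear_map sg sg sg br"
    and left_leibniz: "br x (br y z) = br (br x y) z + br y (br x z)"

text \<open>
  A linear map from \<open>'g\<close> to the endomorphisms of \<open>'v\<close> is given in uncurried form, as a map
  \<open>\<rho> :: 'g \<Rightarrow> 'v \<Rightarrow> 'v\<close> that is linear in each of its two arguments.
\<close>

locale leibniz_representation = leibniz_algebra sg br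
  for sg :: "'k::field_char_0 \<Rightarrow> 'g::ab_group_add \<Rightarrow> 'g"
    and br :: "'g \<Rightarrow> 'g \<Rightarrow> 'g" +
  fixes sv :: "'k \<Rightarrow> 'v::ab_group_add \<Rightarrow> 'v"
    and rhoL rhoR :: "'g \<Rightarrow> 'v \<Rightarrow> 'v"
  assumes fin_dim_module: "fin_dim_vector_space sv"
    and bilinear_rhoL: "bilinear_map sg sv sv rhoL"
    and bilinear_rhoR: "bilinear_map sg sv sv rhoR"
    and rhoL_bracket: "rhoL (br x y) w = rhoL x (rhoL y w) - rhoL y (rhoL x w)"
    and rhoR_bracket: "rhoR (br x y) w = rhoL x (rhoR y w) - rhoR y (rhoL x w)"
    and rhoR_rhoL: "rhoR y (rhoL x w) = - rhoR y (rhoR x w)"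

text \<open>The bracket \<open>[u, v]\<^sup>K\<close>.\<close>

definition operator_bracket ::
  "('g \<Rightarrow> 'v \<Rightarrow> 'v) \<Rightarrow> ('g \<Rightarrow> 'v \<Rightarrow> 'v) \<Rightarrow> ('v \<Rightarrow> 'g) \<Rightarrow> 'v \<Rightarrow> 'v \<Rightarrow> 'v::ab_group_add" where
  "operator_bracket rhoL rhoR K u v = rhoL (K u) v + rhoR (K v) u"

text \<open>
  The deformation of a bracket by an endomorphism. It gives both \<open>[x, y]\<^sub>N\<close> (from the bracket
  of the algebra) and the deformation of \<open>[u, v]\<^sup>K\<close> by \<open>S\<close>.
\<close>

definition deformed_bracket ::
  "('a \<Rightarrow> 'a \<Rightarrow> 'a) \<Rightarrow> ('a \<Rightarrow> 'a) \<Rightarrow> 'a \<Rightarrow> 'a \<Rightarrow> 'a::ab_group_add" where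
  "deformed_bracket br N x y = br (N x) y + br x (N y) - N (br x y)"

locale O_operator = leibniz_representation sg br sv rhoL rhoR
  for sg :: "'k::field_char_0 \<Rightarrow> 'g::ab_group_add \<Rightarrow> 'g"
    and br :: "'g \<Rightarrow> 'g \<Rightarrow> 'g"
    and sv :: "'k \<Rightarrow> 'v::ab_group_add \<Rightarrow> 'v"
    and rhoL rhoR :: "'g \<Rightarrow> 'v \<Rightarrow> 'v" +
  fixes K :: "'v \<Rightarrow> 'g"
  assumes linear_K: "Vector_Spaces.linear sv sg K"
    and O_identity: "br (K u) (K v) = K (operator_bracket rhoL rhoR K u v)"

locale nijenhuis_operator = leibniz_algebra sg br
  for sg :: "'k::field_char_0 \<Rightarrow> 'g::ab_group_add \<Rightarrow> 'g"
    and br :: "'g \<Rightarrow> 'g \<Rightarrow> 'g" +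
  fixes N :: "'g \<Rightarrow> 'g"
  assumes linear_N: "Vector_Spaces.linear sg sg N"
    and nijenhuis_identity: "br (N x) (N y) = N (deformed_bracket br N x y)"

locale nijenhuis_pair =
  leibniz_representation sg br sv rhoL rhoR + nijenhuis_operator sg br N
  for sg :: "'k::field_char_0 \<Rightarrow> 'g::ab_group_add \<Rightarrow> 'g"
    and br :: "'g \<Rightarrow> 'g \<Rightarrow> 'g"
    and sv :: "'k \<Rightarrow> 'v::ab_group_add \<Rightarrow> 'v"
    and rhoL rhoR :: "'g \<Rightarrow> 'v \<Rightarrow> 'v"
    and N :: "'g \<Rightarrow> 'g" +
  fixes S :: "'v \<Rightarrow> 'v"
  assumes linear_S: "Vector_Spaces.linear sv sv S"
    and pair_identity: "rho \<in> {rhoL, rhoR} \<Longrightarrow>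
      rho (N y) (S w) = S (rho (N y) w) + S (rho y (S w)) - S (S (rho y w))"

locale dual_nijenhuis_pair =
  leibniz_representation sg br sv rhoL rhoR + nijenhuis_operator sg br N
  for sg :: "'k::field_char_0 \<Rightarrow> 'g::ab_group_add \<Rightarrow> 'g"
    and br :: "'g \<Rightarrow> 'g \<Rightarrow> 'g"
    and sv :: "'k \<Rightarrow> 'v::ab_group_add \<Rightarrow> 'v"
    and rhoL rhoR :: "'g \<Rightarrow> 'v \<Rightarrow> 'v"
    and N :: "'g \<Rightarrow> 'g" +
  fixes S :: "'v \<Rightarrow> 'v"
  assumes linear_S: "Vector_Spaces.linear sv sv S"
    and dual_pair_identity: "rho \<in> {rhoL, rhoR} \<Longrightarrow>
      rho (N y) (S w) = S (rho (N y) w) + rho y (S (S w)) - S (rho y (S w))"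

locale ON_structure =
  O_operator sg br sv rhoL rhoR K + nijenhuis_pair sg br sv rhoL rhoR N S
  for sg :: "'k::field_char_0 \<Rightarrow> 'g::ab_group_add \<Rightarrow> 'g"
    and br :: "'g \<Rightarrow> 'g \<Rightarrow> 'g"
    and sv :: "'k \<Rightarrow> 'v::ab_group_add \<Rightarrow> 'v"
    and rhoL rhoR :: "'g \<Rightarrow> 'v \<Rightarrow> 'v"
    and K :: "'v \<Rightarrow> 'g"
    and S :: "'v \<Rightarrow> 'v"
    and N :: "'g \<Rightarrow> 'g" +
  assumes NK_KS: "N \<circ> K = K \<circ> S"
    and bracket_compat:
      "operator_bracket rhoL rhoR (N \<circ> K) w u =
       deformed_bracket (operator_bracket rhoL rhoR K) S w u"

locale dual_ON_structure =
  O_operator sg br sv rhoL rhoR K + dual_nijenhuis_pair sg br sv rhoL rhoR N S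
  for sg :: "'k::field_char_0 \<Rightarrow> 'g::ab_group_add \<Rightarrow> 'g"
    and br :: "'g \<Rightarrow> 'g \<Rightarrow> 'g"
    and sv :: "'k \<Rightarrow> 'v::ab_group_add \<Rightarrow> 'v"
    and rhoL rhoR :: "'g \<Rightarrow> 'v \<Rightarrow> 'v"
    and K :: "'v \<Rightarrow> 'g"
    and S :: "'v \<Rightarrow> 'v"
    and N :: "'g \<Rightarrow> 'g" +
  assumes NK_KS: "N \<circ> K = K \<circ> S"
    and bracket_compat:
      "operator_bracket rhoL rhoR (N \<circ> K) w u =
       deformed_bracket (operator_bracket rhoL rhoR K) S w u"

definition hat_rep ::
  "('g \<Rightarrow> 'g) \<Rightarrow> ('v \<Rightarrow> 'v) \<Rightarrow> ('g \<Rightarrow> 'v \<Rightarrow> 'v) \<Rightarrow> 'g \<Rightarrow> 'v \<Rightarrow> 'v::ab_group_add" where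
  "hat_rep N S rho y w = rho (N y) w + rho y (S w) - S (rho y w)"

definition tilde_rep ::
  "('g \<Rightarrow> 'g) \<Rightarrow> ('v \<Rightarrow> 'v) \<Rightarrow> ('g \<Rightarrow> 'v \<Rightarrow> 'v) \<Rightarrow> 'g \<Rightarrow> 'v \<Rightarrow> 'v::ab_group_add" where
  "tilde_rep N S rho y w = rho (N y) w + S (rho y w) - rho y (S w)"

end

theory Submission
  imports Defs
begin

text \<open>
  The heart of the matter is that one bracket on \<open>V\<close>, namely \<open>[u, v]\<^sup>N\<^sup>K\<close>, has three descriptions.
  By hypothesis it is the deformation by \<open>S\<close> of \<open>[u, v]\<^sup>K\<close>. Since \<open>N K = K S\<close>, this hypothesis
  amounts to \<open>S [w, u]\<^sup>K = \<rho>\<^sup>L(K w) (S u) + \<rho>\<^sup>R(K u) (S w)\<close>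
  (\<open>S_operator_bracket\<close>); in the bracket that \<open>K\<close> and the deformed representation define on
  \<open>V\<close>, this makes the terms with \<open>S\<close> cancel, both in the hat version and in the tilde version,
  where they only have opposite signs. So that bracket is \<open>[u, v]\<^sup>N\<^sup>K\<close> once more.

  An \<open>\<O>\<close>-operator \<open>K\<close> is a map that turns \<open>[u, v]\<^sup>K\<close> into the bracket of \<open>\<gg>\<close>. As it also
  intertwines \<open>S\<close> with \<open>N\<close>, it turns the deformation by \<open>S\<close> into the deformation by \<open>N\<close>:
  \<open>[K u, K v]\<^sub>N = K [u, v]\<^sup>N\<^sup>K\<close>. By the third description this is the first claim. Applying
  \<open>N\<close> and the Nijenhuis identity gives \<open>[N K u, N K v] = N K [u, v]\<^sup>N\<^sup>K\<close>, the second claim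
  (\<open>deformed_O_operators\<close>).

  An \<open>\<O>\<close>-operator lives on a representation, so it also has to be shown that the deformed data form
  one (\<open>hat_representation\<close>, \<open>tilde_representation\<close>). That \<open>[x, y]\<^sub>N\<close> is a Leibniz bracket
  requires no separate calculation: \<open>(N, N)\<close> is a Nijenhuis pair for the adjoint
  representation, whose left action then deforms to the map that sends \<open>x\<close> to \<open>[x, _]\<^sub>N\<close>, and
  the compatibility of this left action with the bracket is the Leibniz identity.
\<close>

section \<open>Linear and bilinear maps\<close>

lemma linear_diff_maps:
  assumes "Vector_Spaces.linear s1 s2 f" "Vector_Spaces.linear s1 s2 g"
  shows "Vector_Spaces.linear s1 s2 (\<lambda>x. f x - g x)"
proof -
  have "vector_space_pair s1 s2"
    using assms(1) by (simp add: Vector_Spaces.linear_def vector_space_pair_def)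
  then show ?thesis using assms by (rule vector_space_pair.linear_compose_sub)
qed

lemma linear_add_maps:
  assumes "Vector_Spaces.linear s1 s2 f" "Vector_Spaces.linear s1 s2 g"
  shows "Vector_Spaces.linear s1 s2 (\<lambda>x. f x + g x)"
proof -
  have "vector_space_pair s1 s2"
    using assms(1) by (simp add: Vector_Spaces.linear_def vector_space_pair_def)
  then show ?thesis using assms by (rule vector_space_pair.linear_compose_add)
qed

lemma linear_comp_maps:
  assumes "Vector_Spaces.linear s1 s2 f" "Vector_Spaces.linear s2 s3 g"
  shows "Vector_Spaces.linear s1 s3 (\<lambda>x. g (f x))"
  using Vector_Spaces.linear_compose[OF assms] by (simp add: o_def)

lemma additive_if_linear:
  assumes "Vector_Spaces.linear s1 s2 f"
  shows "f (x + y) = f x + f y" "f (x - y) = f x - f y" "f (- x) = - f x"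
  using assms[THEN module_hom_linearI]
  by (simp_all add: module_hom.add module_hom.diff module_hom.neg)

lemma biadditive_if_bilinear:
  assumes "bilinear_map sa sb sc f"
  shows "f (x + x') y = f x y + f x' y" "f (x - x') y = f x y - f x' y"
    and "f x (y + y') = f x y + f x y'" "f x (y - y') = f x y - f x y'"
proof -
  have 1: "Vector_Spaces.linear sa sc (\<lambda>x. f x y)" and 2: "Vector_Spaces.linear sb sc (\<lambda>y. f x y)"
    using assms by (auto simp: bilinear_map_def)
  show "f (x + x') y = f x y + f x' y" "f (x - x') y = f x y - f x' y"
    using additive_if_linear[OF 1] by auto
  show "f x (y + y') = f x y + f x y'" "f x (y - y') = f x y - f x y'"
    using additive_if_linear[OF 2] by auto
qed

lemma bilinear_hat_rep:
  assumes rho: "bilinear_map sg sv sv rho"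
    and N: "Vector_Spaces.linear sg sg N" and S: "Vector_Spaces.linear sv sv S"
  shows "bilinear_map sg sv sv (hat_rep N S rho)"
  using rho N S unfolding bilinear_map_def hat_rep_def
  by (auto intro!: linear_diff_maps linear_add_maps
      intro: linear_comp_maps[of sg sg N] linear_comp_maps[of sv sv S] linear_comp_maps[of _ _ _ _ S])

lemma bilinear_tilde_rep:
  assumes rho: "bilinear_map sg sv sv rho"
    and N: "Vector_Spaces.linear sg sg N" and S: "Vector_Spaces.linear sv sv S"
  shows "bilinear_map sg sv sv (tilde_rep N S rho)"
  using rho N S unfolding bilinear_map_def tilde_rep_def
  by (auto intro!: linear_diff_maps linear_add_maps
      intro: linear_comp_maps[of sg sg N] linear_comp_maps[of sv sv S] linear_comp_maps[of _ _ _ _ S])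

section \<open>Deformed representations\<close>

text \<open>
  The Nijenhuis identity solved for its term with the highest power of \<open>N\<close>. Used as a rewrite rule,
  it eliminates \<open>N (N _)\<close> on brackets. It also is the Nijenhuis pair identity of \<open>(N, N)\<close> for the
  two adjoint actions.
\<close>

lemma (in nijenhuis_operator) N_N_bracket:
  "N (N (br x y)) = N (br (N x) y) + N (br x (N y)) - br (N x) (N y)"
  using nijenhuis_identity[of x y] additive_if_linear[OF linear_N]
  by (simp add: deformed_bracket_def algebra_simps)

text \<open>
  Both sides are sums of words in \<open>S\<close>, \<open>N\<close> and the actions. The pair identity, read from left to
  right, moves an \<open>S\<close> out of the scope of each \<open>\<rho>(N y)\<close>, and \<open>N_N_bracket\<close> removes the iterated
  \<open>N\<close> that comes from \<open>\<rho>(N [x, y]\<^sub>N)\<close>; the remaining words agree on the two sides.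
\<close>

lemma (in nijenhuis_pair) hat_rep_bracket:
  assumes rho: "rho \<in> {rhoL, rhoR}"
  shows "hat_rep N S rho (deformed_bracket br N x y) w =
    hat_rep N S rhoL x (hat_rep N S rho y w) - hat_rep N S rho y (hat_rep N S rhoL x w)"
proof -
  have bracket: "rho (br x y) w = rhoL x (rho y w) - rho y (rhoL x w)" for x y w
    using rho rhoL_bracket rhoR_bracket by auto
  have bil: "bilinear_map sg sv sv rho"
    using rho bilinear_rhoL bilinear_rhoR by auto
  note additive = additive_if_linear[OF linear_N] additive_if_linear[OF linear_S]
    biadditive_if_bilinear[OF bil] biadditive_if_bilinear[OF bilinear_rhoL]
  have "rhoL \<in> {rhoL, rhoR}" by simp
  note pair = pair_identity[OF rho] pair_identity[OF this]
  show ?thesis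
    by (simp add: hat_rep_def deformed_bracket_def additive bracket N_N_bracket pair)
qed

text \<open>
  The reduction to common words is that of \<open>hat_rep_bracket\<close>: the dual pair identity has the same
  left-hand side \<open>\<rho>(N y) S\<close>, so it rewrites the same words.
\<close>

lemma (in dual_nijenhuis_pair) tilde_rep_bracket:
  assumes rho: "rho \<in> {rhoL, rhoR}"
  shows "tilde_rep N S rho (deformed_bracket br N x y) w =
    tilde_rep N S rhoL x (tilde_rep N S rho y w) - tilde_rep N S rho y (tilde_rep N S rhoL x w)"
proof -
  have bracket: "rho (br x y) w = rhoL x (rho y w) - rho y (rhoL x w)" for x y w
    using rho rhoL_bracket rhoR_bracket by auto
  have bil: "bilinear_map sg sv sv rho"
    using rho bilinear_rhoL bilinear_rhoR by auto
  note additive = additive_if_linear[OF linear_N] additive_if_linear[OF linear_S]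
    biadditive_if_bilinear[OF bil] biadditive_if_bilinear[OF bilinear_rhoL]
  have "rhoL \<in> {rhoL, rhoR}" by simp
  note pair = dual_pair_identity[OF rho] dual_pair_identity[OF this]
  show ?thesis
    by (simp add: tilde_rep_def deformed_bracket_def additive bracket N_N_bracket pair)
qed

text \<open>
  The left and right multiplications. All three axioms are instances of the Leibniz identity; the
  last one says that \<open>[[x, w], y] + [[w, x], y] = 0\<close>, which is the sum of the Leibniz identities for
  \<open>(x, w, y)\<close> and \<open>(w, x, y)\<close>.
\<close>

lemma (in leibniz_algebra) adjoint_representation:
  "leibniz_representation sg br sg br (\<lambda>y x. br x y)"
proof unfold_locales
  show "fin_dim_vector_space sg" by (rule fin_dim_algebra)
  show "bilinear_map sg sg sg br" by (rule bilinear_bracket)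
  then show "bilinear_map sg sg sg (\<lambda>y x. br x y)" by (simp add: bilinear_map_def)
  note additive = biadditive_if_bilinear[OF bilinear_bracket]
  fix x y w
  show "br (br x y) w = br x (br y w) - br y (br x w)" using left_leibniz[of x y w] by simp
  show "br w (br x y) = br x (br w y) - br (br x w) y" using left_leibniz[of x w y] by simp
  show "br (br x w) y = - br (br w x) y"
    using left_leibniz[of x w y] left_leibniz[of w x y]
    by (simp add: algebra_simps eq_neg_iff_add_eq_0)
qed

text \<open>
  The left action of the adjoint representation, deformed by the Nijenhuis pair \<open>(N, N)\<close>, is the
  deformed bracket itself, and \<open>hat_rep_bracket\<close> for it is the Leibniz identity.
\<close>

lemma (in nijenhuis_operator) deformed_leibniz_algebra:
  "leibniz_algebra sg (deformed_bracket br N)"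
proof -
  interpret adj: leibniz_representation sg br sg br "\<lambda>y x. br x y"
    by (rule adjoint_representation)
  interpret adj: nijenhuis_pair sg br sg br "\<lambda>y x. br x y" N N
  proof (intro nijenhuis_pair.intro nijenhuis_pair_axioms.intro)
    fix rho y w assume "rho \<in> {br, \<lambda>y x. br x y}"
    then show "rho (N y) (N w) = N (rho (N y) w) + N (rho y (N w)) - N (N (rho y w))"
      by (auto simp: N_N_bracket)
  qed (fact adj.leibniz_representation_axioms nijenhuis_operator_axioms linear_N)+
  have hat: "hat_rep N N br = deformed_bracket br N"
    by (simp add: fun_eq_iff hat_rep_def deformed_bracket_def)
  show ?thesis
  proof unfold_locales
    show "fin_dim_vector_space sg" by (rule fin_dim_algebra)
    show "bilinear_map sg sg sg (deformed_bracket br N)"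
      using bilinear_hat_rep[OF bilinear_bracket linear_N linear_N] by (simp add: hat)
    show "deformed_bracket br N x (deformed_bracket br N y z) =
        deformed_bracket br N (deformed_bracket br N x y) z +
        deformed_bracket br N y (deformed_bracket br N x z)" for x y z
      using adj.hat_rep_bracket[of br x y z] by (simp add: hat)
  qed
qed

text \<open>
  For the last axiom put \<open>\<sigma> = \<rho>\<^sup>L + \<rho>\<^sup>R\<close>, so that \<open>\<rho>\<^sup>R(y) \<sigma>(x) = 0\<close> for all \<open>x\<close> and
  \<open>y\<close>, and \<open>\<sigma>\<close> satisfies the pair identity as well. Expand the product of the deformed \<open>\<rho>\<^sup>R(y)\<close> and the
  deformed \<open>\<sigma>(x)\<close>. The pair identity for \<open>\<rho>\<^sup>R\<close>, applied to \<open>\<rho>\<^sup>R(N y) S \<sigma>(x)\<close>, cancels the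
  terms that begin with \<open>S\<close>. What is left is \<open>\<rho>\<^sup>R(y)\<close> applied to
  \<open>S \<sigma>(N x) + S \<sigma>(x) S - S\<^sup>2 \<sigma>(x)\<close>, that is, to \<open>\<sigma>(N x) S\<close>, which vanishes.
\<close>

lemma (in nijenhuis_pair) hat_representation:
  "leibniz_representation sg (deformed_bracket br N) sv (hat_rep N S rhoL) (hat_rep N S rhoR)"
proof -
  interpret deformed: leibniz_algebra sg "deformed_bracket br N"
    by (rule deformed_leibniz_algebra)
  note additive = additive_if_linear[OF linear_S]
    biadditive_if_bilinear[OF bilinear_rhoL] biadditive_if_bilinear[OF bilinear_rhoR]
  show ?thesis
  proof unfold_locales
    show "fin_dim_vector_space sv" by (rule fin_dim_module)
    show "bilinear_map sg sv sv (hat_rep N S rhoL)" "bilinear_map sg sv sv (hat_rep N S rhoR)"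
      by (intro bilinear_hat_rep bilinear_rhoL bilinear_rhoR linear_N linear_S)+
    fix x y w
    show "hat_rep N S rhoR y (hat_rep N S rhoL x w) = - hat_rep N S rhoR y (hat_rep N S rhoR x w)"
      \<comment> \<open>\<open>\<rho>\<^sup>R(y) \<sigma>(N x) S w = 0\<close> has to be supplied, since simplification rewrites
        \<open>\<rho>(N x) (S w)\<close> by the pair identity before \<open>rhoR_rhoL\<close> can match.\<close>
      using rhoR_rhoL[of y "N x" "S w"]
      by (simp add: hat_rep_def additive rhoR_rhoL pair_identity[of rhoL] pair_identity[of rhoR] algebra_simps)
  qed (simp_all add: hat_rep_bracket)
qed

text \<open>
  With \<open>\<sigma>\<close> as for \<open>hat_representation\<close>, the dual pair identity for \<open>\<rho>\<^sup>R\<close> now leaves \<open>\<rho>\<^sup>R(y)\<close>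
  applied to \<open>S \<sigma>(x) S - S \<sigma>(N x)\<close>. By the dual pair identity for \<open>\<sigma>\<close> the latter equals
  \<open>\<sigma>(x) S\<^sup>2 - \<sigma>(N x) S\<close>, and \<open>\<rho>\<^sup>R(y)\<close> annihilates both terms.
\<close>

lemma (in dual_nijenhuis_pair) tilde_representation:
  "leibniz_representation sg (deformed_bracket br N) sv (tilde_rep N S rhoL) (tilde_rep N S rhoR)"
proof -
  interpret deformed: leibniz_algebra sg "deformed_bracket br N"
    by (rule deformed_leibniz_algebra)
  note additive = additive_if_linear[OF linear_S]
    biadditive_if_bilinear[OF bilinear_rhoL] biadditive_if_bilinear[OF bilinear_rhoR]
  show ?thesis
  proof unfold_locales
    show "fin_dim_vector_space sv" by (rule fin_dim_module)
    show "bilinear_map sg sv sv (tilde_rep N S rhoL)" "bilinear_map sg sv sv (tilde_rep N S rhoR)"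
      by (intro bilinear_tilde_rep bilinear_rhoL bilinear_rhoR linear_N linear_S)+
    fix x y w
    show "tilde_rep N S rhoR y (tilde_rep N S rhoL x w) = - tilde_rep N S rhoR y (tilde_rep N S rhoR x w)"
      \<comment> \<open>\<open>\<rho>\<^sup>R(y) \<sigma>(N x) S w = 0\<close> has to be supplied, since simplification rewrites
        \<open>\<rho>(N x) (S w)\<close> by the pair identity before \<open>rhoR_rhoL\<close> can match.\<close>
      using rhoR_rhoL[of y "N x" "S w"]
      by (simp add: tilde_rep_def additive rhoR_rhoL dual_pair_identity[of rhoL] dual_pair_identity[of rhoR] algebra_simps)
  qed (simp_all add: tilde_rep_bracket)
qed

section \<open>Deformed operators\<close>

text \<open>
  The argument common to the hat and the tilde case: the deformed actions enter only through the
  bracket that \<open>K\<close> obtains from them.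
\<close>

lemma (in O_operator) deformed_O_operators:
  assumes "nijenhuis_operator sg br N"
    and rep: "leibniz_representation sg (deformed_bracket br N) sv rhoL' rhoR'"
    and intertwine: "N \<circ> K = K \<circ> S"
    and compat: "\<And>w u. operator_bracket rhoL rhoR (N \<circ> K) w u =
       deformed_bracket (operator_bracket rhoL rhoR K) S w u"
    and bracket': "\<And>w u. operator_bracket rhoL' rhoR' K w u = operator_bracket rhoL rhoR (N \<circ> K) w u"
  shows "O_operator sg (deformed_bracket br N) sv rhoL' rhoR' K"
    and "O_operator sg br sv rhoL rhoR (N \<circ> K)"
proof -
  interpret nijenhuis_operator sg br N by fact
  interpret deformed: leibniz_representation sg "deformed_bracket br N" sv rhoL' rhoR' by fact
  have NK: "N (K u) = K (S u)" for u
    using intertwine by (metis comp_apply)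
  have K_hom: "deformed_bracket br N (K u) (K v) = K (operator_bracket rhoL rhoR (N \<circ> K) u v)" for u v
    unfolding compat
    by (simp add: deformed_bracket_def NK O_identity additive_if_linear[OF linear_K])
  show "O_operator sg (deformed_bracket br N) sv rhoL' rhoR' K"
    by (intro O_operator.intro O_operator_axioms.intro rep linear_K) (simp add: K_hom bracket')
  show "O_operator sg br sv rhoL rhoR (N \<circ> K)"
  proof (intro O_operator.intro O_operator_axioms.intro leibniz_representation_axioms)
    show "Vector_Spaces.linear sv sg (N \<circ> K)"
      by (rule Vector_Spaces.linear_compose[OF linear_K linear_N])
    show "br ((N \<circ> K) u) ((N \<circ> K) v) = (N \<circ> K) (operator_bracket rhoL rhoR (N \<circ> K) u v)" for u v
      by (simp add: nijenhuis_identity K_hom)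
  qed
qed

text \<open>
  As \<open>N K = K S\<close>, the terms \<open>\<rho>\<^sup>L(N K w) u\<close> and \<open>\<rho>\<^sup>R(N K u) w\<close> occur on both sides of the
  compatibility condition, and this is what remains of it.
\<close>

lemma S_operator_bracket:
  assumes intertwine: "N \<circ> K = K \<circ> S"
    and compat: "operator_bracket rhoL rhoR (N \<circ> K) w u =
       deformed_bracket (operator_bracket rhoL rhoR K) S w u"
  shows "S (operator_bracket rhoL rhoR K w u) = rhoL (K w) (S u) + rhoR (K u) (S w)"
proof -
  have "N (K u) = K (S u)" for u using intertwine by (metis comp_apply)
  then show ?thesis
    using compat by (simp add: operator_bracket_def deformed_bracket_def algebra_simps)
qed

text \<open>
  In the next two lemmas the terms with \<open>S\<close> add up to plus or minus the difference of the two sides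
  of the first assumption. This is why one condition serves structures and dual structures alike.
\<close>

lemma hat_operator_bracket:
  assumes "S (operator_bracket rhoL rhoR K w u) = rhoL (K w) (S u) + rhoR (K u) (S w)"
    and "Vector_Spaces.linear sv sv S"
  shows "operator_bracket (hat_rep N S rhoL) (hat_rep N S rhoR) K w u =
      operator_bracket rhoL rhoR (N \<circ> K) w u"
  using assms(1)
  by (simp add: operator_bracket_def hat_rep_def additive_if_linear[OF assms(2)] algebra_simps)

lemma tilde_operator_bracket:
  assumes "S (operator_bracket rhoL rhoR K w u) = rhoL (K w) (S u) + rhoR (K u) (S w)"
    and "Vector_Spaces.linear sv sv S"
  shows "operator_bracket (tilde_rep N S rhoL) (tilde_rep N S rhoR) K w u =
      operator_bracket rhoL rhoR (N \<circ> K) w u"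
  using assms(1)
  by (simp add: operator_bracket_def tilde_rep_def additive_if_linear[OF assms(2)] algebra_simps)

theorem proposition4p4:
  fixes sg :: "'k::field_char_0 \<Rightarrow> 'g::ab_group_add \<Rightarrow> 'g"
    and br :: "'g \<Rightarrow> 'g \<Rightarrow> 'g"
    and sv :: "'k \<Rightarrow> 'v::ab_group_add \<Rightarrow> 'v"
    and rhoL rhoR :: "'g \<Rightarrow> 'v \<Rightarrow> 'v"
    and K :: "'v \<Rightarrow> 'g"
    and S :: "'v \<Rightarrow> 'v"
    and N :: "'g \<Rightarrow> 'g"
  shows
    "(ON_structure sg br sv rhoL rhoR K S N \<longrightarrow>
        O_operator sg (deformed_bracket br N) sv (hat_rep N S rhoL) (hat_rep N S rhoR) K \<and>
        O_operator sg br sv rhoL rhoR (N \<circ> K)) \<and>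
     (dual_ON_structure sg br sv rhoL rhoR K S N \<longrightarrow>
        O_operator sg (deformed_bracket br N) sv (tilde_rep N S rhoL) (tilde_rep N S rhoR) K \<and>
        O_operator sg br sv rhoL rhoR (N \<circ> K))"
proof (intro conjI[of "_ \<longrightarrow> _"] impI)
  assume "ON_structure sg br sv rhoL rhoR K S N"
  then interpret ON_structure sg br sv rhoL rhoR K S N .
  have bracket: "operator_bracket (hat_rep N S rhoL) (hat_rep N S rhoR) K w u =
      operator_bracket rhoL rhoR (N \<circ> K) w u" for w u
    using S_operator_bracket[OF NK_KS bracket_compat] linear_S by (rule hat_operator_bracket)
  show "O_operator sg (deformed_bracket br N) sv (hat_rep N S rhoL) (hat_rep N S rhoR) K \<and>
      O_operator sg br sv rhoL rhoR (N \<circ> K)"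
    using deformed_O_operators[OF nijenhuis_operator_axioms hat_representation NK_KS
        bracket_compat bracket] by blast
next
  assume "dual_ON_structure sg br sv rhoL rhoR K S N"
  then interpret dual_ON_structure sg br sv rhoL rhoR K S N .
  have bracket: "operator_bracket (tilde_rep N S rhoL) (tilde_rep N S rhoR) K w u =
      operator_bracket rhoL rhoR (N \<circ> K) w u" for w u
    using S_operator_bracket[OF NK_KS bracket_compat] linear_S by (rule tilde_operator_bracket)
  show "O_operator sg (deformed_bracket br N) sv (tilde_rep N S rhoL) (tilde_rep N S rhoR) K \<and>
      O_operator sg br sv rhoL rhoR (N \<circ> K)"
    using deformed_O_operators[OF nijenhuis_operator_axioms tilde_representation NK_KS
        bracket_compat bracket] by blast
qed

end
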